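(* Let $\mathcal{H}$ be a Hilbert space and let $X=(X_1,\ldots,X_n)\in\mathcal{B}(\mathcal{H})^n$ be a pure commuting $n$-tuple of operators which is regular at $z=0$ and which, for some positive integer $m\ge1$, satisfies $(X^*X)^{-1}=(\oplus\Delta_X)|_{X^*\mathcal{H}}$. Let $T$ be a contraction on $\mathcal{H}$ such that $TX_i=X_iT$ for all $i\in\{1,\ldots,n\}$. Then the following are equivalent: (i) $T$ is a pure contraction on $\mathcal{H}$; (ii) $P_{\mathcal{W}(X)}T|_{\mathcal{W}(X)}$ is a pure contraction on $\mathcal{W}(X)$.
   Context: The tuple $X$ is identified with the row operator $X:\mathcal{H}^n\to\mathcal{H}$, $X(h_i)_{i=1}^n=\sum_{i=1}^nX_ih_i$. Let $\sigma_X:\mathcal{B}(\mathcal{H})\to\mathcal{B}(\mathcal{H})$, $\sigma_X(Y)=\sum_{i=1}^nX_iYX_i^*$. The tuple $X$ is pure if $\sigma_X^k(I_{\mathcal{H}})\to0$ in the strong operator topology as $k\to\infty$. The wandering subspace is $\mathcal{W}(X)=\bigcap_{i=1}^n\ker X_i^*=\mathcal{H}\ominus\sum_iX_i\mathcal{H}$. For $z\in\mathbb{C}^n$ let $Z:\mathcal{H}^n\to\mathcal{H}$, $Z(h_i)_{i=1}^n=\sum_iz_ih_i$. $X$ is regular at $z=0$ if there is a real number $\epsilon>0$ such that for all $\|z\|<\epsilon$ the subspace $(X-Z)\mathcal{H}^n\subset\mathcal{H}$ is closed and $\mathcal{H}$ is the algebraic direct sum $\mathcal{H}=(X-Z)\mathcal{H}^n\oplus\mathcal{W}(X)$.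 For the given $m$, $\Delta_X=\sum_{j=0}^{m-1}(-1)^j\binom{m}{j+1}\sigma_X^j(I_{\mathcal{H}})$, and $\oplus\Delta_X$ is the operator on $\mathcal{H}^n$ acting as $\Delta_X$ on each coordinate. $(X^*X)^{-1}$ denotes the inverse of the invertible operator $X^*X:X^*\mathcal{H}\to X^*\mathcal{H}$ (where $X^*\mathcal{H}\subset\mathcal{H}^n$ is the range of $X^*:\mathcal{H}\to\mathcal{H}^n$, closed since $X\mathcal{H}^n$ is closed). A contraction $T$ on a Hilbert space is pure if $\|T^{*k}h\|\to0$ as $k\to\infty$ for every vector $h$. $P_{\mathcal{W}(X)}$ is the orthogonal projection onto $\mathcal{W}(X)$. *)

theory Defs
  imports "HOL-Analysis.Analysis"
begin

section \<open>Complex Hilbert spaces\<close>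

text \<open>
  The distribution only has real inner product spaces.  A complex Hilbert space is a complete one
  carrying in addition a compatible complex scalar multiplication and a complex inner product,
  linear in its first argument, whose real part is the given real inner product; in particular
  the norm is induced by the complex inner product.  The law 1 x = x and definiteness are inherited
  through the two compatibility axioms.  The zero space is not excluded.
\<close>

class complex_hilbert_space = real_inner + complete_space +
  fixes scaleC :: "complex \<Rightarrow> 'a \<Rightarrow> 'a" (infixr "*\<^sub>C" 75)
    and cinner :: "'a \<Rightarrow> 'a \<Rightarrow> complex"
  assumes scaleC_add_right: "c *\<^sub>C (x + y) = c *\<^sub>C x + c *\<^sub>C y"
    and scaleC_add_left: "(c + d) *\<^sub>C x = c *\<^sub>C x + d *\<^sub>C x"
    and scaleC_scaleC: "c *\<^sub>C (d *\<^sub>C x) = (c * d) *\<^sub>C x"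
    and scaleR_scaleC: "r *\<^sub>R x = complex_of_real r *\<^sub>C x"
    and cinner_commute: "cinner x y = cnj (cinner y x)"
    and cinner_add_left: "cinner (x + y) z = cinner x z + cinner y z"
    and cinner_scaleC_left: "cinner (c *\<^sub>C x) y = c * cinner x y"
    and inner_eq_Re_cinner: "x \<bullet> y = Re (cinner x y)"

instantiation complex :: complex_hilbert_space
begin

definition scaleC_complex :: "complex \<Rightarrow> complex \<Rightarrow> complex" where
  "scaleC_complex c x = c * x"

definition cinner_complex :: "complex \<Rightarrow> complex \<Rightarrow> complex" where
  "cinner_complex x y = x * cnj y"

instance
  by standard
    (auto simp: scaleC_complex_def cinner_complex_def algebra_simps scaleR_conv_of_real
      inner_complex_def)

end

text \<open>The Hilbert space direct sum of copies of a space, indexed by a finite type.\<close>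

instantiation vec :: (complex_hilbert_space, finite) complex_hilbert_space
begin

definition scaleC_vec :: "complex \<Rightarrow> ('a, 'b) vec \<Rightarrow> ('a, 'b) vec" where
  "scaleC_vec c x = (\<chi> i. c *\<^sub>C (x $ i))"

definition cinner_vec :: "('a, 'b) vec \<Rightarrow> ('a, 'b) vec \<Rightarrow> complex" where
  "cinner_vec x y = (\<Sum>i\<in>UNIV. cinner (x $ i) (y $ i))"

instance
proof
  fix x y :: "('a, 'b) vec"
  show "cinner x y = cnj (cinner y x)"
    unfolding cinner_vec_def cnj_sum by (rule sum.cong) (auto intro: cinner_commute)
qed (auto simp: scaleC_vec_def cinner_vec_def vec_eq_iff scaleC_add_right scaleC_add_left
    scaleC_scaleC scaleR_scaleC cinner_add_left cinner_scaleC_left sum.distrib sum_distrib_left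
    inner_vec_def inner_eq_Re_cinner)

end

section \<open>Operators\<close>

definition bounded_clinear ::
    "('a::complex_hilbert_space \<Rightarrow> 'b::complex_hilbert_space) \<Rightarrow> bool" where
  "bounded_clinear A \<longleftrightarrow> bounded_linear A \<and> (\<forall>c x. A (c *\<^sub>C x) = c *\<^sub>C A x)"

text \<open>
  The adjoint of an operator from the closed subspace S to the closed subspace R, these being
  regarded as Hilbert spaces in their own right.  For bounded operators it exists by the
  Riesz representation theorem and its values on R are unique.
\<close>

definition adjoint_on ::
    "'a::complex_hilbert_space set \<Rightarrow> 'b::complex_hilbert_space set \<Rightarrow> ('a \<Rightarrow> 'b) \<Rightarrow> 'b \<Rightarrow> 'a" where
  "adjoint_on S R A = (SOME B. (\<forall>y\<in>R. B y \<in> S) \<and>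
     (\<forall>x\<in>S. \<forall>y\<in>R. cinner (A x) y = cinner x (B y)))"

abbreviation cadjoint ::
    "('a::complex_hilbert_space \<Rightarrow> 'b::complex_hilbert_space) \<Rightarrow> 'b \<Rightarrow> 'a" where
  "cadjoint \<equiv> adjoint_on UNIV UNIV"

definition orth_proj :: "'a::complex_hilbert_space set \<Rightarrow> 'a \<Rightarrow> 'a" where
  "orth_proj S h = (THE p. p \<in> S \<and> (\<forall>s\<in>S. cinner (h - p) s = 0))"

definition contraction_on :: "'a::complex_hilbert_space set \<Rightarrow> ('a \<Rightarrow> 'a) \<Rightarrow> bool" where
  "contraction_on S T \<longleftrightarrow>
     (\<forall>x\<in>S. T x \<in> S) \<and>
     (\<forall>x\<in>S. \<forall>y\<in>S. T (x + y) = T x + T y) \<and>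
     (\<forall>c. \<forall>x\<in>S. T (c *\<^sub>C x) = c *\<^sub>C T x) \<and>
     (\<forall>x\<in>S. norm (T x) \<le> norm x)"

definition pure_contraction_on :: "'a::complex_hilbert_space set \<Rightarrow> ('a \<Rightarrow> 'a) \<Rightarrow> bool" where
  "pure_contraction_on S T \<longleftrightarrow> contraction_on S T \<and>
     (\<forall>h\<in>S. (\<lambda>k. norm ((adjoint_on S S T ^^ k) h)) \<longlonglongrightarrow> 0)"

section \<open>Operator tuples\<close>

definition commuting_tuple :: "('n \<Rightarrow> 'a::complex_hilbert_space \<Rightarrow> 'a) \<Rightarrow> bool" where
  "commuting_tuple X \<longleftrightarrow>
     (\<forall>i. bounded_clinear (X i)) \<and> (\<forall>i j. X i \<circ> X j = X j \<circ> X i)"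

definition row_op :: "('n::finite \<Rightarrow> 'a::complex_hilbert_space \<Rightarrow> 'a) \<Rightarrow> 'a ^ 'n \<Rightarrow> 'a" where
  "row_op X h = (\<Sum>i\<in>UNIV. X i (h $ i))"

definition sigma_op ::
    "('n::finite \<Rightarrow> 'a::complex_hilbert_space \<Rightarrow> 'a) \<Rightarrow> ('a \<Rightarrow> 'a) \<Rightarrow> 'a \<Rightarrow> 'a" where
  "sigma_op X Y = (\<lambda>h. \<Sum>i\<in>UNIV. X i (Y (cadjoint (X i) h)))"

definition pure_tuple :: "('n::finite \<Rightarrow> 'a::complex_hilbert_space \<Rightarrow> 'a) \<Rightarrow> bool" where
  "pure_tuple X \<longleftrightarrow> (\<forall>h. (\<lambda>k. (sigma_op X ^^ k) id h) \<longlonglongrightarrow> 0)"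

definition wandering :: "('n \<Rightarrow> 'a::complex_hilbert_space \<Rightarrow> 'a) \<Rightarrow> 'a set" where
  "wandering X = (\<Inter>i. {h. cadjoint (X i) h = 0})"

definition algebraic_direct_sum :: "'a::complex_hilbert_space set \<Rightarrow> 'a set \<Rightarrow> bool" where
  "algebraic_direct_sum M N \<longleftrightarrow> {a + b | a b. a \<in> M \<and> b \<in> N} = UNIV \<and> M \<inter> N = {0}"

definition regular_at_0 :: "('n::finite \<Rightarrow> 'a::complex_hilbert_space \<Rightarrow> 'a) \<Rightarrow> bool" where
  "regular_at_0 X \<longleftrightarrow> (\<exists>\<epsilon>>0. \<forall>z :: complex ^ 'n. norm z < \<epsilon> \<longrightarrow>
     (let M = range (\<lambda>h. row_op X h - row_op (\<lambda>i. scaleC (z $ i)) h)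
      in closed M \<and> algebraic_direct_sum M (wandering X)))"

definition Delta :: "nat \<Rightarrow> ('n::finite \<Rightarrow> 'a::complex_hilbert_space \<Rightarrow> 'a) \<Rightarrow> 'a \<Rightarrow> 'a" where
  "Delta m X h =
     (\<Sum>j<m. ((-1) ^ j * of_nat (m choose (j + 1))) *\<^sub>C (sigma_op X ^^ j) id h)"

definition ampliation :: "('a \<Rightarrow> 'a) \<Rightarrow> 'a ^ 'n::finite \<Rightarrow> 'a ^ 'n" where
  "ampliation D u = (\<chi> i. D (u $ i))"

text \<open>
  When the row operator has closed range, its composition with the adjoint is a bijection of the
  range of the adjoint onto itself; only the values of the inverse on that range are meaningful.
\<close>

definition gram_inverse ::
    "('n::finite \<Rightarrow> 'a::complex_hilbert_space \<Rightarrow> 'a) \<Rightarrow> 'a ^ 'n \<Rightarrow> 'a ^ 'n" where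
  "gram_inverse X =
     inv_into (range (cadjoint (row_op X))) (cadjoint (row_op X) \<circ> row_op X)"

end

theory Submission
  imports Defs
begin

text \<open>
  Write \<open>W\<close> for the wandering subspace and \<open>P\<close> for its projection.  The hypothesis on the Gram inverse
  reads \<open>P = (1 - \<sigma>)\<^sup>m(I)\<close>.  The set \<open>N\<close> of all \<open>h\<close> with \<open>T\<^sup>*\<^sup>k h \<rightarrow> 0\<close> is a closed subspace, and
  \<open>(P T|W)\<^sup>*\<close> is the restriction of \<open>T\<^sup>*\<close> to \<open>W\<close>, so the claim is that \<open>W \<subseteq> N\<close> forces
  \<open>N\<close> to be everything.  As \<open>1 - P\<close> factors through \<open>X\<^sup>*\<close> and \<open>W \<subseteq> N\<close>, a vector \<open>h\<close>
  lies in \<open>N\<close> as soon as all \<open>X\<^sub>i\<^sup>* h\<close> do.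

  Regularity at 0 provides, for each \<open>w\<close> in \<open>W\<close> and each small \<open>t > 0\<close>, a joint eigenvector
  \<open>v = w + t A\<^sub>c v\<close> with \<open>X\<^sub>i\<^sup>* v = t c\<^sub>i v\<close>; its Taylor coefficients \<open>A\<^sub>c\<^sup>n w\<close> satisfy
  \<open>X\<^sub>i\<^sup>* A\<^sub>c\<^sup>n\<^sup>+\<^sup>1 w = c\<^sub>i A\<^sub>c\<^sup>n w\<close> and therefore lie in \<open>N\<close>.  They span a dense subspace: a vector \<open>h\<close>
  orthogonal to them is orthogonal to \<open>(\<Sum>c\<^sub>i X\<^sub>i)\<^sup>n w\<close>, hence by polarization to all
  \<open>X\<^sup>\<alpha> w\<close>, so \<open>(1 - \<sigma>)\<^sup>m\<close> annihilates the null sequence \<open>k \<mapsto> \<langle>\<sigma>\<^sup>k(I) h, h\<rangle>\<close>, which is only possible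
  if that sequence vanishes.
\<close>

section \<open>Hilbert spaces and adjoints\<close>

text \<open>A minimizing sequence for the distance to \<open>M\<close> is Cauchy by the
  parallelogram law. Orthogonality is with respect to the real inner product; on a complex subspace
  this agrees with complex orthogonality.\<close>

lemma hilbert_projection:
  fixes M :: "'a::{real_inner,complete_space} set"
  assumes "closed M" "subspace M"
  obtains p q where "x = p + q" "p \<in> M" "\<And>s. s \<in> M \<Longrightarrow> q \<bullet> s = 0"
proof -
  define E where "E = (\<lambda>s. (norm (x - s))\<^sup>2) ` M"
  define d where "d = Inf E"
  have E0: "bdd_below E" unfolding E_def by (rule bdd_belowI2[where m=0]) simp
  have "0 \<in> M" using assms subspace_0 by blast
  then have Ene: "E \<noteq> {}" by (auto simp: E_def)
  have le: "d \<le> (norm (x - s))\<^sup>2" if "s \<in> M" for s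
    unfolding d_def by (rule cInf_lower) (use that E0 in \<open>auto simp: E_def\<close>)
  have "\<exists>s\<in>M. (norm (x - s))\<^sup>2 < d + 1 / Suc n" for n
  proof -
    have "Inf E < d + 1 / Suc n" by (simp add: d_def)
    then show ?thesis using cInf_lessD[OF Ene] by (auto simp: E_def)
  qed
  then obtain s where s: "\<And>n. s n \<in> M" "\<And>n. (norm (x - s n))\<^sup>2 < d + 1 / Suc n" by metis
  \<comment> \<open>The midpoint of \<open>s i\<close> and \<open>s j\<close> lies in
    \<open>M\<close>, so its distance to \<open>x\<close> bounds \<open>d\<close> from
    above.\<close>
  have par: "(norm (s i - s j))\<^sup>2 \<le> 2 / Suc i + 2 / Suc j" for i j
  proof -
    have "(1/2) *\<^sub>R (s i + s j) \<in> M" using s assms by (simp add: subspace_add subspace_mul)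
    from le[OF this] have "4 * d \<le> 4 * (norm (x - (1/2) *\<^sub>R (s i + s j)))\<^sup>2" by simp
    also have "\<dots> = 2 * (norm (x - s i))\<^sup>2 + 2 * (norm (x - s j))\<^sup>2 - (norm (s i - s j))\<^sup>2"
      by (simp add: power2_norm_eq_inner inner_diff_left inner_diff_right inner_add_left
          inner_add_right inner_commute algebra_simps)
    finally show ?thesis using s(2)[of i] s(2)[of j] by (simp add: algebra_simps)
  qed
  have "Cauchy s"
  proof (rule metric_CauchyI)
    fix e :: real assume "0 < e"
    then obtain k where k: "4 / e\<^sup>2 < real k" using reals_Archimedean2 by blast
    have "dist (s i) (s j) < e" if "k \<le> i" "k \<le> j" for i j
    proof -
      have "4 < e\<^sup>2 * real (Suc k)" using k \<open>0 < e\<close>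
        by (simp add: field_simps) (smt (verit) zero_less_power)
      then have K: "4 / Suc k < e\<^sup>2" by (simp add: field_simps)
      have "2 / Suc i \<le> 2 / Suc k" "2 / Suc j \<le> 2 / Suc k"
        using that by (simp_all add: frac_le)
      then have "(norm (s i - s j))\<^sup>2 < e\<^sup>2" using par[of i j] K by linarith
      then show ?thesis using \<open>0 < e\<close> by (simp add: dist_norm power2_less_imp_less)
    qed
    then show "\<exists>k. \<forall>i\<ge>k. \<forall>j\<ge>k. dist (s i) (s j) < e" by blast
  qed
  then obtain p where p: "s \<longlonglongrightarrow> p" using Cauchy_convergent_iff convergentD by blast
  have pM: "p \<in> M" using closed_sequentially[OF assms(1)] s(1) p by blast
  have "(\<lambda>n. (norm (x - s n))\<^sup>2) \<longlonglongrightarrow> (norm (x - p))\<^sup>2" by (intro tendsto_intros p)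
  moreover have "(\<lambda>n. d + 1 / Suc n) \<longlonglongrightarrow> d + 0" by (intro tendsto_intros LIMSEQ_Suc lim_1_over_n)
  ultimately have pd: "(norm (x - p))\<^sup>2 \<le> d"
    using LIMSEQ_le s(2) by (metis (no_types, lifting) add.right_neutral less_imp_le)
  have "(x - p) \<bullet> u = 0" if "u \<in> M" for u
  proof (rule ccontr)
    assume ne: "(x - p) \<bullet> u \<noteq> 0"
    then have uu: "u \<bullet> u > 0" by auto
    \<comment> \<open>This \<open>t\<close> minimizes the quadratic polynomial t \<mapsto> |x - p -
      t u|^2; unless \<open>u\<close> is orthogonal to \<open>x - p\<close>, the minimum lies below
      \<open>d\<close>.\<close>
    define t where "t = ((x - p) \<bullet> u) / (u \<bullet> u)"
    have "p + t *\<^sub>R u \<in> M" using pM that assms by (simp add: subspace_add subspace_mul)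
    from le[OF this] pd have "(norm (x - p))\<^sup>2 \<le> (norm (x - (p + t *\<^sub>R u)))\<^sup>2" by linarith
    also have "\<dots> = (norm (x - p))\<^sup>2 - 2 * t * ((x - p) \<bullet> u) + t * t * (u \<bullet> u)"
      by (simp add: power2_norm_eq_inner inner_diff_left inner_diff_right inner_add_left
          inner_add_right inner_commute algebra_simps)
    also have "\<dots> = (norm (x - p))\<^sup>2 - ((x - p) \<bullet> u)\<^sup>2 / (u \<bullet> u)"
      using uu by (simp add: t_def field_simps power2_eq_square)
    finally show False using ne uu by (simp add: divide_le_0_iff)
  qed
  then show ?thesis using that[of p "x - p"] pM by simp
qed

text \<open>The component \<open>q\<close> of \<open>x0\<close> orthogonal to the kernel of
  \<open>f\<close> spans the complement of that kernel, so a multiple of \<open>q\<close> represents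
  \<open>f\<close>.\<close>

lemma riesz_representation:
  fixes f :: "'a::{real_inner,complete_space} \<Rightarrow> real"
  assumes f: "bounded_linear f"
  shows "\<exists>y. \<forall>x. f x = x \<bullet> y"
proof (cases "\<forall>x. f x = 0")
  case True then show ?thesis by (intro exI[of _ 0]) simp
next
  case False
  then obtain x0 where x0: "f x0 \<noteq> 0" by blast
  interpret bounded_linear f by fact
  have "closed (f -` {0})" using f
    by (intro continuous_closed_vimage) (auto intro: linear_continuous_at)
  moreover have "subspace (f -` {0})" by (auto simp: subspace_def add scaleR zero)
  ultimately obtain p q where pq: "x0 = p + q" "f p = 0" "\<And>s. f s = 0 \<Longrightarrow> q \<bullet> s = 0"
    using hilbert_projection[of "f -` {0}" x0] by (metis vimage_singleton_eq)
  have fq: "f q \<noteq> 0" using pq x0 add by auto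
  then have qq: "q \<bullet> q \<noteq> 0" using zero by auto
  have "f x = x \<bullet> ((f q / (q \<bullet> q)) *\<^sub>R q)" for x
  proof -
    have "f (x - (f x / f q) *\<^sub>R q) = 0" using fq by (simp add: diff scaleR)
    then have "q \<bullet> (x - (f x / f q) *\<^sub>R q) = 0" by (rule pq(3))
    then have "x \<bullet> q = (f x / f q) * (q \<bullet> q)" by (simp add: inner_diff_right inner_commute)
    then show ?thesis using fq qq by (simp add: field_simps)
  qed
  then show ?thesis by blast
qed

section \<open>Complex scalars and adjoints of bounded operators\<close>

lemma inner_scaleC_left: "(c *\<^sub>C x) \<bullet> y = x \<bullet> (cnj c *\<^sub>C y)"
  for x y :: "'a::complex_hilbert_space"
proof -
  have "cinner x (cnj c *\<^sub>C y) = cnj (cinner (cnj c *\<^sub>C y) x)" by (rule cinner_commute)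
  also have "\<dots> = c * cinner x y" by (simp add: cinner_scaleC_left cinner_commute[of x y])
  finally show ?thesis by (simp add: inner_eq_Re_cinner cinner_scaleC_left)
qed

lemma scaleC_one [simp]: "1 *\<^sub>C x = x" for x :: "'a::complex_hilbert_space"
  using scaleR_scaleC[of 1 x] by simp

lemma norm_scaleC: "norm (c *\<^sub>C x) = cmod c * norm x" for x :: "'a::complex_hilbert_space"
proof -
  have "(norm (c *\<^sub>C x))\<^sup>2 = x \<bullet> ((cnj c * c) *\<^sub>C x)"
    by (simp add: power2_norm_eq_inner inner_scaleC_left scaleC_scaleC)
  also have "cnj c * c = complex_of_real ((cmod c)\<^sup>2)"
    by (metis complex_norm_square mult.commute)
  also have "x \<bullet> (complex_of_real ((cmod c)\<^sup>2) *\<^sub>C x) = (cmod c * norm x)\<^sup>2"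
    by (simp add: power2_norm_eq_inner power_mult_distrib flip: scaleR_scaleC)
  finally show ?thesis by (simp add: power2_eq_iff_nonneg)
qed

lemma bounded_linear_scaleC: "bounded_linear (\<lambda>x::'a::complex_hilbert_space. c *\<^sub>C x)"
  by (rule bounded_linear_intro[where K="cmod c"])
    (simp_all add: scaleC_add_right scaleR_scaleC scaleC_scaleC norm_scaleC mult.commute)

lemma bounded_clinearD:
  assumes "bounded_clinear A"
  shows "bounded_linear A" "A (c *\<^sub>C x) = c *\<^sub>C A x"
  using assms by (auto simp: bounded_clinear_def)

text \<open>The imaginary part of the complex inner product is the real part after multiplying by
  -i. This lets most arguments below run in the real inner product.\<close>

lemma cinner_eqI:
  fixes x y :: "'a::complex_hilbert_space" and x' y' :: "'b::complex_hilbert_space"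
  assumes "\<And>c. (c *\<^sub>C x) \<bullet> y = (c *\<^sub>C x') \<bullet> y'"
  shows "cinner x y = cinner x' y'"
  using assms[of 1] assms[of "-\<i>"]
  by (simp add: complex_eq_iff inner_eq_Re_cinner cinner_scaleC_left)

lemma inner_left_eqI: "(\<And>x. x \<bullet> a = x \<bullet> b) \<Longrightarrow> a = (b::'a::real_inner)"
  using vector_eq_ldot by blast

lemma cadjoint_eqI:
  fixes A :: "'a::complex_hilbert_space \<Rightarrow> 'b::complex_hilbert_space"
  assumes "\<And>x y. cinner (A x) y = cinner x (B y)"
  shows "cadjoint A = B"
proof
  fix y
  let ?Q = "\<lambda>B. (\<forall>y\<in>UNIV. B y \<in> UNIV) \<and> (\<forall>x\<in>UNIV. \<forall>y\<in>UNIV. cinner (A x) y = cinner x (B y))"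
  have "?Q (cadjoint A)"
    unfolding adjoint_on_def by (rule someI[of ?Q B]) (use assms in blast)
  then have "\<forall>x. x \<bullet> cadjoint A y = x \<bullet> B y" by (metis UNIV_I assms inner_eq_Re_cinner)
  then show "cadjoint A y = B y" by (metis inner_left_eqI)
qed

lemma cinner_cadjoint:
  fixes A :: "'a::complex_hilbert_space \<Rightarrow> 'b::complex_hilbert_space"
  assumes A: "bounded_clinear A"
  shows "cinner (A x) y = cinner x (cadjoint A y)"
proof -
  have "bounded_linear (\<lambda>x. A x \<bullet> y)" for y
    by (rule bounded_linear_compose[OF bounded_linear_inner_left bounded_clinearD(1)[OF A]])
  then have "\<forall>y. \<exists>z. \<forall>x. A x \<bullet> y = x \<bullet> z" using riesz_representation by blast
  then obtain B where B: "\<And>x y. A x \<bullet> y = x \<bullet> B y" by metis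
  then have "cinner (A x) y = cinner x (B y)" for x y
    by (intro cinner_eqI) (metis bounded_clinearD(2)[OF A])
  then show ?thesis using cadjoint_eqI by metis
qed

lemma inner_cadjoint:
  assumes "bounded_clinear A"
  shows "A x \<bullet> y = x \<bullet> cadjoint A y" "y \<bullet> A x = cadjoint A y \<bullet> x"
proof -
  show "A x \<bullet> y = x \<bullet> cadjoint A y"
    by (simp add: inner_eq_Re_cinner cinner_cadjoint[OF assms])
  then show "y \<bullet> A x = cadjoint A y \<bullet> x" by (metis inner_commute)
qed

lemma bounded_clinear_cadjoint:
  assumes A: "bounded_clinear A"
  shows "bounded_clinear (cadjoint A)"
proof -
  obtain K where K: "\<And>x. norm (A x) \<le> norm x * K" "K \<ge> 0"
    using bounded_linear.nonneg_bounded[OF bounded_clinearD(1)[OF A]] by blast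
  have "norm (cadjoint A y) \<le> norm y * K" for y
  proof -
    have "norm (cadjoint A y) * norm (cadjoint A y) = A (cadjoint A y) \<bullet> y"
      unfolding inner_cadjoint[OF A] by (simp add: dot_square_norm power2_eq_square)
    also have "\<dots> \<le> norm (A (cadjoint A y)) * norm y" by (rule norm_cauchy_schwarz)
    also have "\<dots> \<le> norm (cadjoint A y) * (norm y * K)"
      using mult_right_mono[OF K(1)[of "cadjoint A y"], of "norm y"] by (simp add: ac_simps)
    finally show ?thesis using K(2)
      by (cases "norm (cadjoint A y) = 0") (auto simp: mult_le_cancel_left)
  qed
  moreover have "cadjoint A (x + y) = cadjoint A x + cadjoint A y" for x y
    by (rule inner_left_eqI) (simp add: inner_add_right flip: inner_cadjoint[OF A])
  moreover have c: "cadjoint A (c *\<^sub>C y) = c *\<^sub>C cadjoint A y" for c y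
  proof (rule inner_left_eqI)
    fix x
    have "x \<bullet> cadjoint A (c *\<^sub>C y) = A (cnj c *\<^sub>C x) \<bullet> y"
      by (simp add: inner_scaleC_left bounded_clinearD(2)[OF A] flip: inner_cadjoint[OF A])
    also have "\<dots> = x \<bullet> (c *\<^sub>C cadjoint A y)" by (simp add: inner_cadjoint[OF A] inner_scaleC_left)
    finally show "x \<bullet> cadjoint A (c *\<^sub>C y) = x \<bullet> (c *\<^sub>C cadjoint A y)" .
  qed
  moreover have "cadjoint A (r *\<^sub>R y) = r *\<^sub>R cadjoint A y" for r y
    by (simp add: scaleR_scaleC c)
  ultimately show ?thesis unfolding bounded_clinear_def
    by (auto intro!: bounded_linear_intro)
qed

lemma bounded_clinear_compose:
  assumes "bounded_clinear A" "bounded_clinear B"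
  shows "bounded_clinear (\<lambda>x. A (B x))"
  using assms by (auto simp: bounded_clinear_def bounded_linear_compose)

lemma bounded_clinear_id: "bounded_clinear id"
  unfolding id_def by (auto simp: bounded_clinear_def bounded_linear_ident)

lemma scaleC_zero_right [simp]: "c *\<^sub>C 0 = (0::'a::complex_hilbert_space)"
  using scaleC_add_right[of c 0 0] by simp

lemma scaleC_sum_right: "c *\<^sub>C (\<Sum>i\<in>S. f i) = (\<Sum>i\<in>S. c *\<^sub>C (f i :: 'a::complex_hilbert_space))"
  by (induction S rule: infinite_finite_induct) (simp_all add: scaleC_add_right)

lemma scaleC_commute: "c *\<^sub>C d *\<^sub>C x = d *\<^sub>C c *\<^sub>C (x :: 'a::complex_hilbert_space)"
  by (simp add: scaleC_scaleC mult.commute)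

lemma bounded_clinear_sum:
  "(\<And>i. i \<in> S \<Longrightarrow> bounded_clinear (A i)) \<Longrightarrow> bounded_clinear (\<lambda>x. \<Sum>i\<in>S. A i x)"
  by (auto simp: bounded_clinear_def scaleC_sum_right bounded_linear_sum)

lemma bounded_clinear_scaleC: "bounded_clinear (\<lambda>x::'a::complex_hilbert_space. c *\<^sub>C x)"
  by (simp add: bounded_clinear_def bounded_linear_scaleC scaleC_commute)

lemma bounded_linear_funpow:
  fixes A :: "'a::real_normed_vector \<Rightarrow> 'a"
  assumes "bounded_linear A"
  shows "bounded_linear (A ^^ k)"
proof (induction k)
  case (Suc k)
  then show ?case using bounded_linear_compose[OF assms] by (simp add: o_def)
qed (simp add: id_def bounded_linear_ident)

lemma cinner_zero_left [simp]: "cinner 0 x = 0" for x :: "'a::complex_hilbert_space"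
  using cinner_add_left[of 0 0 x] by simp

lemma cinner_sum_left:
  "cinner (\<Sum>i\<in>S. f i) x = (\<Sum>i\<in>S. cinner (f i) (x::'a::complex_hilbert_space))"
  by (induction S rule: infinite_finite_induct) (simp_all add: cinner_add_left)

section \<open>Iterated differences\<close>

text \<open>This is 1 minus the shift; with this sign, nonnegative differences mean a decreasing
  sequence.\<close>

definition fdiff :: "(nat \<Rightarrow> 'a::real_vector) \<Rightarrow> nat \<Rightarrow> 'a" where
  "fdiff a k = a k - a (Suc k)"

lemma fdiff_funpow:
  fixes a :: "nat \<Rightarrow> 'a::real_vector"
  shows "(fdiff ^^ m) a k = (\<Sum>j\<le>m. ((-1) ^ j * real (m choose j)) *\<^sub>R a (k + j))"
proof (induction m arbitrary: k)
  case (Suc m)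
  define g where "g j = (-1) ^ j * real (m choose j)" for j
  have "(\<Sum>j\<le>Suc m. ((-1) ^ j * real (Suc m choose j)) *\<^sub>R a (k + j))
    = a k + (\<Sum>j\<le>m. (g (Suc j) - g j) *\<^sub>R a (k + Suc j))"
  proof -
    \<comment> \<open>Pascal's rule, with the sign absorbed into \<open>g\<close>.\<close>
    have "(-1) ^ Suc j * real (Suc m choose Suc j) = g (Suc j) - g j" for j
      by (simp add: g_def algebra_simps)
    then show ?thesis by (subst sum.atMost_Suc_shift) simp
  qed
  also have "\<dots> = (a k + (\<Sum>j\<le>m. g (Suc j) *\<^sub>R a (k + Suc j))) - (\<Sum>j\<le>m. g j *\<^sub>R a (Suc k + j))"
    by (simp add: scaleR_diff_left sum_subtractf)
  also have "a k + (\<Sum>j\<le>m. g (Suc j) *\<^sub>R a (k + Suc j)) = (\<Sum>j\<le>Suc m. g j *\<^sub>R a (k + j))"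
    by (subst sum.atMost_Suc_shift) (simp add: g_def)
  also have "\<dots> = (\<Sum>j\<le>m. g j *\<^sub>R a (k + j))" by (simp add: g_def)
  finally show ?case by (simp add: Suc.IH g_def fdiff_def[of "(fdiff ^^ m) a"])
qed simp

lemma fdiff_funpow_linear:
  "linear f \<Longrightarrow> (fdiff ^^ m) (\<lambda>k. f (a k)) k = f ((fdiff ^^ m) a k)"
  by (simp add: fdiff_funpow linear_sum linear_cmul)

text \<open>By induction the first difference, again a null sequence, is nonnegative; so
  \<open>a\<close> decreases to its limit 0.\<close>

lemma fdiff_funpow_nonneg:
  fixes a :: "nat \<Rightarrow> real"
  assumes "\<And>k. (fdiff ^^ m) a k \<ge> 0" "a \<longlonglongrightarrow> 0"
  shows "a k \<ge> 0"
  using assms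
proof (induction m arbitrary: a k)
  case (Suc m)
  have "fdiff a k \<ge> 0" for k
  proof (rule Suc.IH)
    show "(fdiff ^^ m) (fdiff a) k \<ge> 0" for k using Suc.prems(1)[of k]
      by (simp del: funpow.simps add: funpow_Suc_right)
    show "fdiff a \<longlonglongrightarrow> 0" unfolding fdiff_def using tendsto_diff[OF Suc.prems(2) LIMSEQ_Suc[OF Suc.prems(2)]] by simp
  qed
  then have "decseq a" by (intro decseq_SucI) (simp add: fdiff_def)
  then show ?case using Suc.prems(2) by (rule decseq_ge)
qed simp

lemma fdiff_funpow_decseq:
  fixes a :: "nat \<Rightarrow> real"
  assumes "\<And>k. (fdiff ^^ m) a k \<ge> 0" "a \<longlonglongrightarrow> 0" "m \<ge> 1"
  shows "decseq a"
proof -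
  obtain n where m: "m = Suc n" using assms(3) by (cases m) auto
  have "fdiff a k \<ge> 0" for k
  proof (rule fdiff_funpow_nonneg)
    show "(fdiff ^^ n) (fdiff a) k \<ge> 0" for k using assms(1)[of k]
      by (simp add: m del: funpow.simps add: funpow_Suc_right)
    show "fdiff a \<longlonglongrightarrow> 0" unfolding fdiff_def using tendsto_diff[OF assms(2) LIMSEQ_Suc[OF assms(2)]] by simp
  qed
  then show ?thesis by (intro decseq_SucI) (simp add: fdiff_def)
qed

text \<open>The product rule, with commutation collecting the n equal terms. For n = 0 the truncated
  exponent is harmless because of the factor \<open>real n\<close>. The formula serves for
  polarization.\<close>

lemma funpow_pencil_deriv:
  fixes A B :: "'a::real_normed_vector \<Rightarrow> 'a"
  assumes A: "bounded_linear A" and B: "bounded_linear B" and AB: "\<And>x. A (B x) = B (A x)"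
  shows "((\<lambda>t. ((\<lambda>x. A x + t *\<^sub>R B x) ^^ n) x) has_vector_derivative
    real n *\<^sub>R (A ^^ (n - 1)) (B x)) (at 0)"
proof (induction n)
  case (Suc n)
  let ?f = "\<lambda>t. ((\<lambda>x. A x + t *\<^sub>R B x) ^^ n) x"
  have f0: "?f 0 = (A ^^ n) x" by simp
  have comm: "B ((A ^^ k) y) = (A ^^ k) (B y)" for k y by (induction k) (simp_all flip: AB)
  have "((\<lambda>t. A (?f t) + t *\<^sub>R B (?f t)) has_vector_derivative
      A (real n *\<^sub>R (A ^^ (n - 1)) (B x)) + (0 *\<^sub>R B (real n *\<^sub>R (A ^^ (n - 1)) (B x)) + 1 *\<^sub>R B (?f 0))) (at 0)"
    by (intro has_vector_derivative_add has_vector_derivative_scaleR bounded_linear.has_vector_derivative[OF A]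
       bounded_linear.has_vector_derivative[OF B] Suc.IH) (auto intro!: derivative_eq_intros)
  moreover have "A (real n *\<^sub>R (A ^^ (n - 1)) (B x)) = real n *\<^sub>R (A ^^ n) (B x)"
    using A by (cases n) (simp_all add: linear_simps)
  ultimately show ?case by (simp add: f0 comm algebra_simps)
qed simp

section \<open>The wandering projection\<close>

locale delta_tuple =
  fixes X :: "'n::finite \<Rightarrow> 'a::complex_hilbert_space \<Rightarrow> 'a" and m :: nat
  assumes commuting: "commuting_tuple X"
    and pure: "pure_tuple X"
    and regular: "regular_at_0 X"
    and m_ge_1: "m \<ge> 1"
    and gram: "\<forall>u \<in> range (cadjoint (row_op X)). gram_inverse X u = ampliation (Delta m X) u"
begin

abbreviation V :: "'n \<Rightarrow> 'a \<Rightarrow> 'a" where "V i \<equiv> cadjoint (X i)"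

abbreviation W :: "'a set" where "W \<equiv> wandering X"

lemma bounded_clinear_X: "bounded_clinear (X i)"
  using commuting by (simp add: commuting_tuple_def)

lemma X_commute: "X i (X j x) = X j (X i x)"
  using commuting by (metis commuting_tuple_def comp_apply)

lemmas bounded_clinear_V = bounded_clinear_cadjoint[OF bounded_clinear_X]
lemmas bounded_linear_X = bounded_clinearD(1)[OF bounded_clinear_X]
lemmas bounded_linear_V = bounded_clinearD(1)[OF bounded_clinear_V]
lemmas X_simps = linear_simps[OF bounded_linear_X] bounded_clinearD(2)[OF bounded_clinear_X]
lemmas V_simps = linear_simps[OF bounded_linear_V] bounded_clinearD(2)[OF bounded_clinear_V]
lemmas inner_X = inner_cadjoint[OF bounded_clinear_X]

abbreviation S :: "nat \<Rightarrow> 'a \<Rightarrow> 'a" where "S k \<equiv> (sigma_op X ^^ k) id"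

lemma wandering_iff: "w \<in> W \<longleftrightarrow> (\<forall>i. V i w = 0)"
  by (simp add: wandering_def)

lemma subspace_W: "subspace W"
  by (auto simp: subspace_def wandering_iff V_simps)

lemma cadjoint_row_op: "cadjoint (row_op X) h = (\<chi> i. V i h)"
proof -
  have "cadjoint (row_op X) = (\<lambda>h. \<chi> i. V i h)"
    by (rule cadjoint_eqI)
      (simp add: row_op_def cinner_sum_left cinner_vec_def cinner_cadjoint[OF bounded_clinear_X])
  then show ?thesis by simp
qed

lemma bounded_clinear_sigma:
  assumes "bounded_clinear Y"
  shows "bounded_clinear (sigma_op X Y)"
  unfolding sigma_op_def
  by (intro bounded_clinear_sum bounded_clinear_compose[OF bounded_clinear_X]
      bounded_clinear_compose[OF assms bounded_clinear_V])

lemma bounded_clinear_sigma_pow: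
  "bounded_clinear Y \<Longrightarrow> bounded_clinear ((sigma_op X ^^ k) Y)"
  by (induction k) (simp_all add: bounded_clinear_sigma)

lemma bounded_clinear_Delta: "bounded_clinear (Delta m X)"
proof -
  have "Delta m X = (\<lambda>h. \<Sum>j<m. ((-1) ^ j * of_nat (m choose (j + 1))) *\<^sub>C (sigma_op X ^^ j) id h)"
    by (rule ext) (simp add: Delta_def)
  then show ?thesis
    by (simp only:) (intro bounded_clinear_sum bounded_clinear_compose[OF bounded_clinear_scaleC]
      bounded_clinear_sigma_pow bounded_clinear_id)
qed

lemmas bounded_linear_Delta = bounded_clinearD(1)[OF bounded_clinear_Delta]
lemmas Delta_simps = linear_simps[OF bounded_linear_Delta] bounded_clinearD(2)[OF bounded_clinear_Delta]

lemma sigma_pow_Suc: "(sigma_op X ^^ Suc k) Y h = (\<Sum>i\<in>UNIV. X i ((sigma_op X ^^ k) Y (V i h)))"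
  by (simp add: sigma_op_def)

text \<open>So far this is only I minus \<open>row_op X\<close> composed with \<oplus>\<Delta> and
  the adjoint of \<open>row_op X\<close>. The Gram hypothesis, used through \<open>V_Delta\<close>,
  makes it the orthogonal projection onto \<open>W\<close>.\<close>

definition P :: "'a \<Rightarrow> 'a" where
  "P h = h - (\<Sum>i\<in>UNIV. X i (Delta m X (V i h)))"

lemma bounded_clinear_P: "bounded_clinear P"
proof -
  have *: "bounded_clinear (\<lambda>h. \<Sum>i\<in>UNIV. X i (Delta m X (V i h)))"
    by (intro bounded_clinear_sum bounded_clinear_compose[OF bounded_clinear_X]
      bounded_clinear_compose[OF bounded_clinear_Delta] bounded_clinear_V)
  have "bounded_linear P"
    unfolding P_def [abs_def] by (intro bounded_linear_sub bounded_linear_ident bounded_clinearD(1)[OF *])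
  moreover have "P (c *\<^sub>C h) = c *\<^sub>C P h" for c h
  proof -
    have "P (c *\<^sub>C h) = c *\<^sub>C h - c *\<^sub>C (\<Sum>i\<in>UNIV. X i (Delta m X (V i h)))"
      using bounded_clinearD(2)[OF *, of c h] by (simp only: P_def)
    also have "\<dots> = c *\<^sub>C P h" by (simp only: P_def linear_simps(2)[OF bounded_linear_scaleC])
    finally show ?thesis .
  qed
  ultimately show ?thesis by (simp add: bounded_clinear_def)
qed

lemmas bounded_linear_P = bounded_clinearD(1)[OF bounded_clinear_P]
lemmas P_simps = linear_simps[OF bounded_linear_P] bounded_clinearD(2)[OF bounded_clinear_P]

text \<open>The coefficients of \<Delta> are those of (1 - (1 - x)^m) / x, so the formula for
  \<open>P\<close> collapses to (1 - \<sigma>)^m applied to I.\<close>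

lemma P_eq: "P h = (\<Sum>j\<le>m. ((-1) ^ j * real (m choose j)) *\<^sub>R S j h)"
proof -
  have c: "((-1) ^ j * of_nat r) *\<^sub>C x = ((-1) ^ j * real r) *\<^sub>R x" for j r and x :: 'a
    by (simp add: scaleR_scaleC)
  have "(\<Sum>i\<in>UNIV. X i (Delta m X (V i h)))
      = (\<Sum>i\<in>UNIV. \<Sum>j<m. ((-1) ^ j * real (m choose Suc j)) *\<^sub>R X i (S j (V i h)))"
    unfolding Delta_def c linear_sum[OF bounded_linear.linear[OF bounded_linear_X]] X_simps by simp
  also have "\<dots> = (\<Sum>j<m. ((-1) ^ j * real (m choose Suc j)) *\<^sub>R S (Suc j) h)"
    unfolding sigma_pow_Suc scaleR_sum_right by (rule sum.swap)
  finally have "P h = h - (\<Sum>j<m. ((-1) ^ j * real (m choose Suc j)) *\<^sub>R S (Suc j) h)"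
    by (simp only: P_def)
  also have "\<dots> = (\<Sum>j<Suc m. ((-1) ^ j * real (m choose j)) *\<^sub>R S j h)"
    by (subst sum.lessThan_Suc_shift) (simp add: sum_negf del: funpow.simps(2))
  finally show ?thesis by (simp only: lessThan_Suc_atMost)
qed

lemma sigma_pow_P:
  "(sigma_op X ^^ k) P h = (fdiff ^^ m) (\<lambda>k. S k h) k"
proof (induction k arbitrary: h)
  case 0 show ?case by (simp only: fdiff_funpow funpow_0 add_0 P_eq)
next
  case (Suc k)
  have "(sigma_op X ^^ Suc k) P h
      = (\<Sum>i\<in>UNIV. \<Sum>j\<le>m. ((-1) ^ j * real (m choose j)) *\<^sub>R X i (S (k + j) (V i h)))"
    unfolding sigma_pow_Suc Suc.IH fdiff_funpow
      linear_sum[OF bounded_linear.linear[OF bounded_linear_X]] X_simps by simp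
  also have "\<dots> = (\<Sum>j\<le>m. ((-1) ^ j * real (m choose j)) *\<^sub>R (sigma_op X ^^ Suc (k + j)) id h)"
    unfolding sigma_pow_Suc scaleR_sum_right by (rule sum.swap)
  finally show ?case by (simp only: fdiff_funpow add_Suc)
qed

text \<open>
  \<open>gram_inverse\<close> takes one and the same unspecified value off the image of the Gram operator.
  As \<open>\<oplus>\<Delta>\<close> is linear, this value would be 0 and \<open>X\<close> would vanish, so the hypothesis forces
  the Gram operator to be onto; no closed range theorem is needed.
\<close>

lemma V_Delta: "V i (\<Sum>j\<in>UNIV. X j (Delta m X (V j h))) = V i h"
proof -
  define G where "G = cadjoint (row_op X)"
  define D where "D = (ampliation (Delta m X) :: 'a ^ 'n \<Rightarrow> 'a ^ 'n)"
  define R where "R = range G"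
  define f where "f = G \<circ> row_op X"
  have G: "G h = (\<chi> i. V i h)" for h by (simp add: G_def cadjoint_row_op)
  have f: "f u = (\<chi> i. V i (\<Sum>j\<in>UNIV. X j (u $ j)))" for u by (simp add: f_def G row_op_def)
  have D: "D u = (\<chi> i. Delta m X (u $ i))" for u by (simp add: D_def ampliation_def)
  have G_add: "G (x + y) = G x + G y" and G_scale: "G (r *\<^sub>R x) = r *\<^sub>R G x" for x y r
    by (simp_all add: G vec_eq_iff V_simps)
  have D_add: "D (x + y) = D x + D y" and D_scale: "D (r *\<^sub>R x) = r *\<^sub>R D x" for x y r
    by (simp_all add: D vec_eq_iff Delta_simps)
  have f_add: "f (x + y) = f x + f y" and f_scale: "f (r *\<^sub>R x) = r *\<^sub>R f x" for x y r
    by (simp_all add: f vec_eq_iff V_simps X_simps sum.distrib flip: scaleR_sum_right)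
  have "linear G" "linear f" by (rule linearI, simp_all add: G_add G_scale f_add f_scale)+
  then have sub: "subspace R" and fsub: "subspace (f ` R)"
    by (simp_all add: R_def linear_subspace_image)
  have inv: "D u = inv_into R f u" if "u \<in> R" for u
    using gram that unfolding R_def f_def G_def D_def gram_inverse_def by metis
  have onto: "u0 \<in> f ` R" if u0: "u0 \<in> R" for u0
  proof (rule ccontr)
    assume n0: "u0 \<notin> f ` R"
    \<comment> \<open>Off the image, \<open>inv_into\<close> chooses from an empty predicate, hence
      always returns the same vector.\<close>
    have junk: "D u = D u0" if "u \<in> R" "u \<notin> f ` R" for u
    proof -
      have *: "inv_into R f u = (SOME x. False)" if "u \<notin> f ` R" for u
        unfolding inv_into_def using that by (intro arg_cong[where f=Eps]) blast
      show ?thesis using that u0 n0 by (simp add: inv *)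
    qed
    \<comment> \<open>Both \<open>u0\<close> and its double lie off the image, so linearity of
      \<open>D\<close> forces the common value to be 0.\<close>
    have "2 *\<^sub>R u0 \<notin> f ` R"
    proof
      assume "2 *\<^sub>R u0 \<in> f ` R"
      from subspace_mul[OF fsub this, of "1/2"] n0 show False by simp
    qed
    then have "2 *\<^sub>R D u0 = D u0" using junk[of "2 *\<^sub>R u0"] sub u0 by (simp add: subspace_mul D_scale)
    then have D0: "D u0 = 0" by (simp add: scaleR_2)
    have Dz: "D u = 0" if "u \<in> R" for u
    proof (cases "u \<in> f ` R")
      case True
      then have "u + u0 \<notin> f ` R" using subspace_diff[OF fsub, of "u + u0" u] n0 by auto
      then have "D (u + u0) = 0" using junk D0 that u0 sub by (simp add: subspace_add)
      then show ?thesis using D0 by (simp add: D_add)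
    qed (use junk that D0 in simp)
    have fz: "f (G h) = 0" for h
    proof -
      have "f (G h) \<in> R" "f (G h) \<in> f ` R" by (auto simp: R_def f_def)
      then have "f (D (f (G h))) = f (G h)" by (simp add: inv f_inv_into_f)
      then show ?thesis using Dz[OF \<open>f (G h) \<in> R\<close>] f_scale[of 0 0] by simp
    qed
    \<comment> \<open>With \<open>g\<close> the row operator applied to \<open>G h\<close>,
      \<open>fz\<close> says that every \<open>V i\<close> kills \<open>g\<close>. Hence
      \<open>g\<close> is orthogonal to itself, and then \<open>G h\<close> has norm 0.\<close>
    have "G h = 0" for h
    proof -
      define g where "g = (\<Sum>j\<in>UNIV. X j (V j h))"
      have Vg: "V i g = 0" for i using fz[of h] by (simp add: f G vec_eq_iff g_def)
      have "g \<bullet> g = (\<Sum>j\<in>UNIV. V j h \<bullet> V j g)" by (subst g_def) (simp add: inner_sum_left inner_X(1))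
      then have "g = 0" by (simp add: Vg)
      then have "0 = (\<Sum>j\<in>UNIV. X j (V j h) \<bullet> h)" by (simp add: g_def flip: inner_sum_left)
      then have "(\<Sum>j\<in>UNIV. V j h \<bullet> V j h) = 0" by (simp add: inner_X(1))
      then show ?thesis by (simp add: G vec_eq_iff sum_nonneg_eq_0_iff)
    qed
    then have "u0 = 0" using u0 by (auto simp: R_def)
    then show False using n0 subspace_0[OF fsub] by simp
  qed
  have "f (D (G h)) = G h"
    using onto[of "G h"] by (simp add: inv R_def f_inv_into_f)
  then show ?thesis by (simp add: f D G vec_eq_iff)
qed

lemma V_P: "V i (P h) = 0"
  by (simp add: P_def V_simps V_Delta)

lemma P_in_W: "P h \<in> W"
  by (simp add: wandering_iff V_P)

lemma P_W: "w \<in> W \<Longrightarrow> P w = w"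
  by (simp add: wandering_iff P_def Delta_simps X_simps)

lemma inner_X_W: "w \<in> W \<Longrightarrow> X i x \<bullet> w = 0"
  by (simp add: wandering_iff inner_X)

lemma P_perp: "w \<in> W \<Longrightarrow> (h - P h) \<bullet> w = 0"
  by (simp add: P_def inner_sum_left inner_X_W)

lemma inner_P_W: "w \<in> W \<Longrightarrow> P h \<bullet> w = h \<bullet> w"
  using P_perp[of w h] by (simp add: inner_diff_left)

lemma P_X: "P (X i x) = 0"
  using inner_P_W[OF P_in_W, of "X i x" "X i x"] by (simp add: inner_X_W P_in_W)

lemma norm_P_le: "norm (P h) \<le> norm h"
proof -
  have "norm (P h) * norm (P h) \<le> norm h * norm (P h)"
    using inner_P_W[OF P_in_W, of h h] norm_cauchy_schwarz[of h "P h"]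
    by (simp add: dot_square_norm power2_eq_square)
  then show ?thesis by (cases "P h = 0") auto
qed

lemma orth_proj_W: "orth_proj W h = P h"
  unfolding orth_proj_def
proof (rule the_equality)
  have "(c *\<^sub>C (h - P h)) \<bullet> s = 0" if "s \<in> W" for s c
  proof -
    \<comment> \<open>Stability of \<open>W\<close> under complex scalars upgrades real
      orthogonality to complex orthogonality.\<close>
    have "cnj c *\<^sub>C s \<in> W" using that by (simp add: wandering_iff V_simps)
    then show ?thesis by (simp add: inner_scaleC_left P_perp)
  qed
  then have "cinner (h - P h) s = cinner 0 s" if "s \<in> W" for s
    using that by (intro cinner_eqI) simp
  then show "P h \<in> W \<and> (\<forall>s\<in>W. cinner (h - P h) s = 0)" by (simp add: P_in_W)
next
  fix p assume p: "p \<in> W \<and> (\<forall>s\<in>W. cinner (h - p) s = 0)"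
  then have "P h - p \<in> W" using subspace_diff[OF subspace_W] P_in_W by blast
  then have "(h - p) \<bullet> (P h - p) = 0" "(h - P h) \<bullet> (P h - p) = 0"
    using p by (simp_all add: P_perp) (simp add: inner_eq_Re_cinner)
  then have "(P h - p) \<bullet> (P h - p) = 0" by (simp add: inner_diff_left)
  then show "p = P h" by simp
qed

section \<open>Joint eigenvectors of the adjoint tuple\<close>

text \<open>If \<open>V i v\<close> is t times \<open>c i\<close> times \<open>v\<close> for all i,
  then \<open>v - P v\<close> is t times \<open>A c v\<close>. Iterating expands \<open>v\<close>
  formally as the power series in t with coefficients \<open>(A c ^^ n) (P v)\<close>.\<close>

definition A :: "('n \<Rightarrow> complex) \<Rightarrow> 'a \<Rightarrow> 'a" where
  "A c h = (\<Sum>i\<in>UNIV. X i (Delta m X (c i *\<^sub>C h)))"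

lemma bounded_linear_A: "bounded_linear (A c)"
  unfolding A_def [abs_def]
  by (intro bounded_linear_sum bounded_linear_compose[OF bounded_linear_X]
      bounded_linear_compose[OF bounded_linear_Delta] bounded_linear_scaleC)

lemma P_A: "P (A c h) = 0"
  by (simp add: A_def linear_sum[OF bounded_linear.linear[OF bounded_linear_P]] P_X)

lemma eigenvector_decomp:
  assumes "\<And>i. V i v = t *\<^sub>R c i *\<^sub>C v"
  shows "v = P v + t *\<^sub>R A c v"
  by (simp add: P_def A_def assms Delta_simps X_simps scaleR_sum_right)

text \<open>Regularity is restricted to the ray through the conjugate of \<open>c\<close>: taking
  adjoints removes the conjugation, so the orthogonal complement of the range consists of joint
  eigenvectors with eigenvalues t times \<open>c i\<close>. The summand 1 in \<epsilon> covers
  \<open>c = 0\<close>.\<close>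

lemma regular_slice:
  obtains \<epsilon> where "\<epsilon> > 0"
    "\<And>t. 0 < t \<Longrightarrow> t < \<epsilon> \<Longrightarrow>
      closed (range (\<lambda>h. \<Sum>i\<in>UNIV. X i (h $ i) - t *\<^sub>R cnj (c i) *\<^sub>C (h $ i :: 'a)))"
    "\<And>t. 0 < t \<Longrightarrow> t < \<epsilon> \<Longrightarrow>
      range (\<lambda>h. \<Sum>i\<in>UNIV. X i (h $ i) - t *\<^sub>R cnj (c i) *\<^sub>C (h $ i)) \<inter> W = {0}"
proof -
  let ?M = "\<lambda>z::complex^'n. range (\<lambda>h. row_op X h - row_op (\<lambda>i. scaleC (z $ i)) h)"
  obtain e where e: "e > 0"
    and "\<forall>z. norm z < e \<longrightarrow> (let M = ?M z in closed M \<and> algebraic_direct_sum M W)"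
    using regular unfolding regular_at_0_def by blast
  then have reg: "closed (?M z) \<and> ?M z \<inter> W = {0}" if "norm z < e" for z
    using that by (simp add: Let_def algebraic_direct_sum_def)
  define \<zeta> :: "complex ^ 'n" where "\<zeta> = (\<chi> i. cnj (c i))"
  define \<epsilon> where "\<epsilon> = e / (norm \<zeta> + 1)"
  have \<epsilon>: "\<epsilon> > 0" using e by (simp add: \<epsilon>_def add_nonneg_pos)
  have n: "norm (t *\<^sub>R \<zeta>) < e" if "0 < t" "t < \<epsilon>" for t
  proof -
    have "t * (norm \<zeta> + 1) < e" using that by (simp add: \<epsilon>_def pos_less_divide_eq add_nonneg_pos)
    then have "t * norm \<zeta> < e" using that by (simp add: distrib_left)
    then show ?thesis using that by simp
  qed
  have \<zeta>: "(t *\<^sub>R \<zeta>) $ i = of_real t * cnj (c i)" for t i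
    unfolding vector_scaleR_component by (simp add: \<zeta>_def scaleR_conv_of_real)
  have eq: "row_op X h - row_op (\<lambda>i. scaleC ((t *\<^sub>R \<zeta>) $ i)) h
      = (\<Sum>i\<in>UNIV. X i (h $ i) - t *\<^sub>R cnj (c i) *\<^sub>C (h $ i))" for t h
    unfolding \<zeta> by (simp add: row_op_def sum_subtractf scaleR_scaleC scaleC_scaleC)
  show ?thesis using that[OF \<epsilon>] reg[OF n] unfolding eq by blast
qed

text \<open>The joint eigenspace \<open>M'\<close> is the orthogonal complement of \<open>M\<close>.
  For small t, \<open>P\<close> is bounded below on \<open>M'\<close>, so its image there is closed.
  A vector of \<open>W\<close> orthogonal to that image is orthogonal to \<open>M'\<close>, hence
  lies in the closed subspace \<open>M\<close>; as \<open>M \<inter> W = {0}\<close>, the image is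
  all of \<open>W\<close>.\<close>

lemma eigenvectors:
  obtains \<epsilon> where "\<epsilon> > 0"
    "\<And>t w. 0 < t \<Longrightarrow> t < \<epsilon> \<Longrightarrow> w \<in> W \<Longrightarrow>
      \<exists>v. v = w + t *\<^sub>R A c v \<and> norm v \<le> 2 * norm w \<and> (\<forall>i. V i v = t *\<^sub>R c i *\<^sub>C v)"
proof -
  let ?f = "\<lambda>t h. \<Sum>i\<in>UNIV. X i (h $ i) - t *\<^sub>R cnj (c i) *\<^sub>C (h $ i)"
  obtain e where e: "e > 0" "\<And>t. 0 < t \<Longrightarrow> t < e \<Longrightarrow> closed (range (?f t))"
    "\<And>t. 0 < t \<Longrightarrow> t < e \<Longrightarrow> range (?f t) \<inter> W = {0}"
    using regular_slice[of c] by blast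
  obtain K where K: "K > 0" "\<And>h. norm (A c h) \<le> norm h * K"
    using bounded_linear.pos_bounded[OF bounded_linear_A] by blast
  have "\<exists>v. v = w + t *\<^sub>R A c v \<and> norm v \<le> 2 * norm w \<and> (\<forall>i. V i v = t *\<^sub>R c i *\<^sub>C v)"
    if t: "0 < t" "t < min e (1 / (2 * K))" and w: "w \<in> W" for t w
  proof -
    define M where "M = range (?f t)"
    have "linear (?f t)"
      by (intro bounded_linear.linear bounded_linear_sum bounded_linear_sub
          bounded_linear_compose[OF bounded_linear_X] bounded_linear_vec_nth
          bounded_linear_compose[OF bounded_linear_scaleR_right]
          bounded_linear_compose[OF bounded_linear_scaleC])
    then have subM: "subspace M" unfolding M_def by (rule linear_subspace_image) simp
    have clM: "closed M" and MW: "M \<inter> W = {0}" using e t by (simp_all add: M_def)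
    define M' where "M' = {v. \<forall>i. V i v = t *\<^sub>R c i *\<^sub>C v}"
    have M'_iff: "v \<in> M' \<longleftrightarrow> (\<forall>s\<in>M. s \<bullet> v = 0)" for v
    proof -
      have *: "?f t h \<bullet> v = (\<Sum>i\<in>UNIV. h $ i \<bullet> (V i v - t *\<^sub>R c i *\<^sub>C v))" for h
        by (simp add: inner_sum_left inner_diff_left inner_diff_right inner_X(1) inner_scaleC_left)
      show ?thesis
      proof
        assume "\<forall>s\<in>M. s \<bullet> v = 0"
        then have z: "(\<Sum>i\<in>UNIV. h $ i \<bullet> (V i v - t *\<^sub>R c i *\<^sub>C v)) = 0" for h :: "'a ^ 'n"
          using *[of h] by (simp add: M_def)
        from z[of "\<chi> i. V i v - t *\<^sub>R c i *\<^sub>C v"] show "v \<in> M'"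
          by (simp add: sum_nonneg_eq_0_iff M'_def)
      qed (auto simp: M_def * M'_def)
    qed
    have dec: "v = P v + t *\<^sub>R A c v" if "v \<in> M'" for v
      using that by (intro eigenvector_decomp) (simp add: M'_def)
    \<comment> \<open>The bound t < 1 / (2 K) lets half of \<open>norm v\<close> be absorbed on the
      left.\<close>
    have bd: "norm v \<le> 2 * norm (P v)" if "v \<in> M'" for v
    proof -
      have "norm v \<le> norm (P v) + t * norm (A c v)"
        using dec[OF that] norm_triangle_ineq[of "P v" "t *\<^sub>R A c v"] t by simp
      also have "t * norm (A c v) \<le> t * (norm v * K)" using K t by (simp add: mult_left_mono)
      also have "\<dots> \<le> norm v / 2"
        using mult_right_mono[of "t * K" "1/2" "norm v"] t K by (simp add: field_simps)
      finally show ?thesis by simp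
    qed
    have subM': "subspace M'" by (auto simp: subspace_def M'_iff inner_add_right)
    have "M' = (\<Inter>s\<in>M. {v. s \<bullet> v = 0})" by (auto simp: M'_iff)
    then have clM': "closed M'" by (auto intro!: closed_INT closed_Collect_eq continuous_intros)
    have "complete (P ` M')"
      by (rule complete_isometric_image[of "1/2"])
        (use subM' clM' bounded_linear_P in \<open>auto simp: complete_eq_closed bd mult.commute\<close>)
    then have cl: "closed (P ` M')" by (simp add: complete_eq_closed)
    have sub: "subspace (P ` M')"
      using linear_subspace_image[OF bounded_linear.linear[OF bounded_linear_P] subM'] .
    obtain p q where pq: "w = p + q" "p \<in> P ` M'" "\<And>s. s \<in> P ` M' \<Longrightarrow> q \<bullet> s = 0"
      using hilbert_projection[OF cl sub] by metis
    have "p \<in> W" using pq(2) P_in_W by auto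
    then have qW: "q \<in> W" using pq(1) subspace_diff[OF subspace_W w] by force
    have qM': "q \<bullet> v = 0" if "v \<in> M'" for v
      using pq(3)[of "P v"] inner_P_W[OF qW, of v] that by (auto simp: inner_commute)
    \<comment> \<open>Splitting \<open>q\<close> along \<open>M\<close> leaves a remainder
      \<open>b\<close> in \<open>M'\<close>, to which \<open>q\<close> is orthogonal; so
      \<open>b = 0\<close>.\<close>
    obtain a b where ab: "q = a + b" "a \<in> M" "\<And>s. s \<in> M \<Longrightarrow> b \<bullet> s = 0"
      using hilbert_projection[OF clM subM] by metis
    then have "b \<in> M'" by (simp add: M'_iff inner_commute)
    then have "b \<bullet> b = 0" using qM'[of b] ab(1) ab(3)[OF ab(2)]
      by (simp add: inner_add_left inner_commute[of a b])
    then have "q \<in> M \<inter> W" using ab qW by simp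
    then have "q = 0" using MW by blast
    then obtain v where "v \<in> M'" "w = P v" using pq by auto
    then show ?thesis using dec bd by (auto simp: M'_def)
  qed
  moreover have "min e (1 / (2 * K)) > 0" using e K by simp
  ultimately show ?thesis using that by blast
qed

text \<open>Letting the eigenvectors tend to \<open>w\<close> gives the same relations for their Taylor coefficients.\<close>

lemma V_A_pow:
  assumes w: "w \<in> W"
  shows "V i ((A c ^^ Suc n) w) = c i *\<^sub>C (A c ^^ n) w"
proof -
  obtain \<epsilon> where \<epsilon>: "\<epsilon> > 0" and ex: "\<And>t. 0 < t \<Longrightarrow> t < \<epsilon> \<Longrightarrow>
      \<exists>v. v = w + t *\<^sub>R A c v \<and> norm v \<le> 2 * norm w \<and> (\<forall>i. V i v = t *\<^sub>R c i *\<^sub>C v)"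
    using eigenvectors[of c] w by metis
  \<comment> \<open>A null sequence inside the open interval; the offset 2 keeps already
    \<open>t 0\<close> below \<epsilon>.\<close>
  define t where "t k = \<epsilon> / (real k + 2)" for k
  have t: "0 < t k" "t k < \<epsilon>" for k using \<epsilon> by (simp_all add: t_def field_simps add_pos_nonneg)
  have t0: "t \<longlonglongrightarrow> 0" unfolding t_def by real_asymp
  obtain v where v: "\<And>k. v k = w + t k *\<^sub>R A c (v k)" "\<And>k. norm (v k) \<le> 2 * norm w"
    "\<And>k i. V i (v k) = t k *\<^sub>R c i *\<^sub>C v k" using ex[OF t] by metis
  obtain K where K: "K > 0" "\<And>h. norm (A c h) \<le> norm h * K"
    using bounded_linear.pos_bounded[OF bounded_linear_A] by blast
  have "(\<lambda>k. v k - w) \<longlonglongrightarrow> 0"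
  proof (rule Lim_null_comparison)
    have "norm (v k - w) \<le> t k * (2 * norm w * K)" for k
    proof -
      have "norm (v k - w) = t k * norm (A c (v k))" using v(1)[of k] t(1)[of k]
        by (metis abs_of_pos add_diff_cancel_left' norm_scaleR)
      also have "norm (A c (v k)) \<le> 2 * norm w * K"
        using K(2)[of "v k"] mult_right_mono[OF v(2)[of k], of K] K(1) by linarith
      finally show ?thesis using t(1)[of k] by (simp add: mult_left_mono)
    qed
    then show "\<forall>\<^sub>F k in sequentially. norm (v k - w) \<le> t k * (2 * norm w * K)" by simp
    show "(\<lambda>k. t k * (2 * norm w * K)) \<longlonglongrightarrow> 0" using t0 by (rule tendsto_mult_left_zero)
  qed
  then have vw: "v \<longlonglongrightarrow> w" by (simp add: LIM_zero_iff)
  have U: "bounded_linear (A c ^^ n)" for n by (rule bounded_linear_funpow[OF bounded_linear_A])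
  note U_simps = linear_simps[OF U]
  have step: "t k *\<^sub>R (A c ^^ Suc n) (v k) = (A c ^^ n) (v k) - (A c ^^ n) w" for n k
  proof -
    have "t k *\<^sub>R A c (v k) = v k - w" using v(1)[of k] by (simp add: algebra_simps)
    then have "(A c ^^ n) (t k *\<^sub>R A c (v k)) = (A c ^^ n) (v k - w)" by simp
    then show ?thesis by (simp add: funpow_Suc_right U_simps del: funpow.simps(2))
  qed
  have lim: "V i ((A c ^^ Suc n) w) = c i *\<^sub>C (A c ^^ n) w"
    if "\<And>k. V i ((A c ^^ Suc n) (v k)) = c i *\<^sub>C (A c ^^ n) (v k)" for n
  proof (rule LIMSEQ_unique)
    show "(\<lambda>k. V i ((A c ^^ Suc n) (v k))) \<longlonglongrightarrow> V i ((A c ^^ Suc n) w)"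
      by (intro bounded_linear.tendsto[OF bounded_linear_V] bounded_linear.tendsto[OF U] vw)
    show "(\<lambda>k. V i ((A c ^^ Suc n) (v k))) \<longlonglongrightarrow> c i *\<^sub>C (A c ^^ n) w"
      unfolding that
      by (intro bounded_linear.tendsto[OF bounded_linear_scaleC] bounded_linear.tendsto[OF U] vw)
  qed
  \<comment> \<open>The relation is proved along the eigenvectors first. To raise n, its limit at
    \<open>w\<close> is subtracted and the factor \<open>t k\<close> from \<open>step\<close> is
    cancelled; for n = 0 the subtracted term vanishes because \<open>w\<close> lies in
    \<open>W\<close>.\<close>
  have "V i ((A c ^^ Suc n) (v k)) = c i *\<^sub>C (A c ^^ n) (v k)" for k
  proof (induction n arbitrary: k)
    case 0
    have "t k *\<^sub>R V i (A c (v k)) = V i (v k) - V i w"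
      using step[of k 0] by (simp flip: V_simps)
    also have "\<dots> = t k *\<^sub>R c i *\<^sub>C v k" using w by (simp add: v(3) wandering_iff)
    finally show ?case using t(1)[of k] by simp
  next
    case (Suc n)
    have "t k *\<^sub>R V i ((A c ^^ Suc (Suc n)) (v k))
        = V i ((A c ^^ Suc n) (v k)) - V i ((A c ^^ Suc n) w)"
      using step[of k "Suc n"] by (simp flip: V_simps)
    also have "\<dots> = c i *\<^sub>C ((A c ^^ n) (v k) - (A c ^^ n) w)"
      using Suc.IH lim[OF Suc.IH] linear_simps(2)[OF bounded_linear_scaleC] by metis
    also have "\<dots> = t k *\<^sub>R c i *\<^sub>C (A c ^^ Suc n) (v k)"
      unfolding step[symmetric] by (simp add: scaleR_scaleC scaleC_commute)
    finally show ?case using t(1)[of k] by simp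
  qed
  then show ?thesis by (rule lim)
qed

section \<open>Density of the Taylor coefficients\<close>

definition Y :: "('n \<Rightarrow> complex) \<Rightarrow> 'a \<Rightarrow> 'a" where
  "Y c x = (\<Sum>i\<in>UNIV. X i (c i *\<^sub>C x))"

lemma bounded_linear_Y: "bounded_linear (Y c)"
  unfolding Y_def [abs_def]
  by (intro bounded_linear_sum bounded_linear_compose[OF bounded_linear_X] bounded_linear_scaleC)

lemma Y_commute: "Y c (Y d x) = Y d (Y c x)"
proof -
  have "Y c (Y d x) = (\<Sum>i\<in>UNIV. \<Sum>j\<in>UNIV. c i *\<^sub>C d j *\<^sub>C X i (X j x))" for c d
    by (simp add: Y_def X_simps scaleC_sum_right linear_sum[OF bounded_linear.linear[OF bounded_linear_X]])
  then have "Y c (Y d x) = (\<Sum>i\<in>UNIV. \<Sum>j\<in>UNIV. c i *\<^sub>C d j *\<^sub>C X i (X j x))" .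
  also have "\<dots> = (\<Sum>j\<in>UNIV. \<Sum>i\<in>UNIV. c i *\<^sub>C d j *\<^sub>C X i (X j x))" by (rule sum.swap)
  also have "\<dots> = (\<Sum>j\<in>UNIV. \<Sum>i\<in>UNIV. d j *\<^sub>C c i *\<^sub>C X j (X i x))"
    by (simp only: scaleC_commute[of "c _" "d _"] X_commute)
  also have "\<dots> = Y d (Y c x)"
    by (simp add: Y_def X_simps scaleC_sum_right linear_sum[OF bounded_linear.linear[OF bounded_linear_X]])
  finally show ?thesis .
qed

text \<open>Polarization stays within the family \<open>Y\<close>.\<close>

lemma Y_pencil: "Y c x + t *\<^sub>R Y d x = Y (\<lambda>i. c i + of_real t * d i) x"
  by (simp add: Y_def X_simps scaleC_add_left sum.distrib scaleC_sum_right scaleR_scaleC scaleC_scaleC)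

lemma sigma_pow_W: "w \<in> W \<Longrightarrow> bounded_clinear Z \<Longrightarrow> (sigma_op X ^^ Suc k) Z w = 0"
  using linear_0[OF bounded_linear.linear[OF bounded_clinearD(1)[OF bounded_clinear_sigma_pow]], of Z k]
  by (simp add: sigma_pow_Suc wandering_iff X_simps del: funpow.simps(2))

lemma sigma_pow_A:
  assumes "w \<in> W" "bounded_clinear Z"
  shows "(sigma_op X ^^ Suc k) Z ((A c ^^ Suc n) w) = Y c ((sigma_op X ^^ k) Z ((A c ^^ n) w))"
  using bounded_clinearD(2)[OF bounded_clinear_sigma_pow[OF assms(2)]]
  by (simp only: sigma_pow_Suc V_A_pow[OF assms(1)] Y_def)

text \<open>Each application of \<sigma> lowers the Taylor exponent by one through
  \<open>V_A_pow\<close> and puts one \<open>Y c\<close> in front. Once the exponent is 0, a further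
  application meets a vector of \<open>W\<close> and gives 0.\<close>

lemma sigma_pow_Taylor:
  assumes w: "w \<in> W" and Z: "bounded_clinear Z"
  shows "(sigma_op X ^^ k) Z ((A c ^^ n) w)
    = (if k \<le> n then (Y c ^^ k) (Z ((A c ^^ (n - k)) w)) else 0)"
proof (induction k arbitrary: n)
  case (Suc k)
  show ?case
  proof (cases n)
    case 0
    then show ?thesis using sigma_pow_W[OF w Z] by (simp del: funpow.simps(2))
  next
    case (Suc n')
    then show ?thesis
      using sigma_pow_A[OF w Z, where c=c and k=k and n=n'] Suc.IH[of n'] linear_simps(3)[OF bounded_linear_Y]
      by (simp del: funpow.simps(2)) simp
  qed
qed simp

lemma sigma_pow_id_Taylor:
  "w \<in> W \<Longrightarrow> S k ((A c ^^ n) w) = (if k \<le> n then (Y c ^^ k) ((A c ^^ (n - k)) w) else 0)"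
  by (simp add: sigma_pow_Taylor[OF _ bounded_clinear_id])

text \<open>\<open>P\<close> annihilates the range of \<open>A c\<close>, so only the term with no
  power of \<open>A c\<close> left survives.\<close>

lemma sigma_pow_P_Taylor:
  assumes w: "w \<in> W"
  shows "(sigma_op X ^^ k) P ((A c ^^ n) w) = (if k = n then (Y c ^^ k) w else 0)"
proof -
  have "P ((A c ^^ Suc l) w) = 0" for l by (simp add: P_A)
  then have "P ((A c ^^ (n - k)) w) = 0" if "k < n"
    using that by (metis Suc_diff_Suc)
  then show ?thesis
    using linear_simps(3)[OF bounded_linear_funpow[OF bounded_linear_Y], of k c]
    by (auto simp: sigma_pow_Taylor[OF w bounded_clinear_P] P_W[OF w])
qed

lemma fdiff_inner_sigma:
  "(fdiff ^^ m) (\<lambda>k. s * (h \<bullet> S k u)) k = s * (h \<bullet> (sigma_op X ^^ k) P u)"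
proof -
  have "linear (\<lambda>x. s * (h \<bullet> x))" by (rule linearI) (simp_all add: inner_add_right algebra_simps)
  from fdiff_funpow_linear[OF this] show ?thesis by (simp only: sigma_pow_P)
qed

text \<open>
  The \<open>m\<close>-th difference of \<open>k \<mapsto> \<langle>h, \<sigma>\<^sup>k(I) A\<^sub>c\<^sup>n w\<rangle>\<close> is supported at \<open>k = n\<close>, so up to sign this
  sequence is decreasing; it vanishes at 0, and its value at \<open>n\<close> is the one in question.
\<close>

lemma orth_Taylor_imp_orth_Y:
  assumes w: "w \<in> W" and h: "h \<bullet> (A c ^^ n) w = 0"
  shows "h \<bullet> (Y c ^^ n) w = 0"
proof -
  \<comment> \<open>The factor \<open>s\<close> makes the single nonzero difference nonnegative; the
    choices 1 and -1 treat both possible signs.\<close>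
  have "s * (h \<bullet> (Y c ^^ n) w) \<le> 0" if nonneg: "s * (h \<bullet> (Y c ^^ n) w) \<ge> 0" for s
  proof -
    define a where "a k = s * (h \<bullet> S k ((A c ^^ n) w))" for k
    have "decseq a"
    proof (rule fdiff_funpow_decseq[OF _ _ m_ge_1])
      show "0 \<le> (fdiff ^^ m) a k" for k
        unfolding a_def [abs_def] fdiff_inner_sigma sigma_pow_P_Taylor[OF w] using nonneg by auto
      have "\<forall>\<^sub>F k in sequentially. a k = 0"
        using eventually_gt_at_top[of n] by eventually_elim (simp add: a_def sigma_pow_id_Taylor[OF w])
      then show "a \<longlonglongrightarrow> 0" by (rule tendsto_eventually)
    qed
    then have "a n \<le> a 0" by (simp add: decseqD)
    then show ?thesis using h by (simp add: a_def sigma_pow_id_Taylor[OF w])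
  qed
  from this[of 1] this[of "-1"] show ?thesis by fastforce
qed

text \<open>The subspace \<open>G\<close> contains \<open>W\<close> and is stable under every
  \<open>X i\<close>, so it contains all values of \<open>(sigma_op X ^^ k) P\<close>. Hence the
  sequence of the numbers \<open>h \<bullet> S k h\<close> has vanishing m-th difference. Being null
  by purity, it vanishes, and its value at 0 is the squared norm of \<open>h\<close>.\<close>

lemma orth_Taylor_imp_zero:
  assumes h: "\<And>c n w. w \<in> W \<Longrightarrow> h \<bullet> (A c ^^ n) w = 0"
  shows "h = 0"
proof -
  \<comment> \<open>Quantifying over all \<open>c\<close> and \<open>n\<close> at once is what makes
    \<open>G\<close> stable under \<open>Y d\<close>; the case n = 0 returns orthogonality to
    \<open>h\<close>.\<close>
  define G where "G = {x. \<forall>c n. h \<bullet> (Y c ^^ n) x = 0}"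
  have Ylin: "linear (Y c ^^ n)" for c n
    by (rule bounded_linear.linear[OF bounded_linear_funpow[OF bounded_linear_Y]])
  have sub: "subspace G"
    by (auto simp: subspace_def G_def linear_0[OF Ylin] linear_add[OF Ylin] linear_cmul[OF Ylin] inner_add_right)
  have W_G: "w \<in> G" if "w \<in> W" for w
    using that h orth_Taylor_imp_orth_Y by (simp add: G_def)
  \<comment> \<open>polarization: differentiate \<open>\<langle>h, (Y\<^sub>c + t Y\<^sub>d)\<^sup>n\<^sup>+\<^sup>1 x\<rangle> = 0\<close> at \<open>t = 0\<close>\<close>
  have Y_G: "Y d x \<in> G" if x: "x \<in> G" for d x
  proof -
    have "h \<bullet> (Y c ^^ n) (Y d x) = 0" for c n
    proof -
      have "((\<lambda>t. h \<bullet> ((\<lambda>x. Y c x + t *\<^sub>R Y d x) ^^ Suc n) x) has_vector_derivative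
          h \<bullet> (real (Suc n) *\<^sub>R (Y c ^^ (Suc n - 1)) (Y d x))) (at 0)"
        by (intro bounded_linear.has_vector_derivative[OF bounded_linear_inner_right]
            funpow_pencil_deriv bounded_linear_Y Y_commute)
      moreover have "h \<bullet> ((\<lambda>x. Y c x + t *\<^sub>R Y d x) ^^ Suc n) x = 0" for t
        unfolding Y_pencil using x unfolding G_def by blast
      ultimately have "((\<lambda>t::real. 0::real) has_vector_derivative
          h \<bullet> (real (Suc n) *\<^sub>R (Y c ^^ (Suc n - 1)) (Y d x))) (at 0)"
        by simp
      then have "h \<bullet> (real (Suc n) *\<^sub>R (Y c ^^ (Suc n - 1)) (Y d x)) = 0"
        using vector_derivative_unique_at has_vector_derivative_const by blast
      then show ?thesis by simp
    qed
    then show ?thesis by (simp add: G_def)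
  qed
  have X_G: "X i x \<in> G" if "x \<in> G" for i x
  proof -
    have "Y (\<lambda>j. if j = i then 1 else 0) x = (\<Sum>j\<in>UNIV. if j = i then X j x else 0)"
      unfolding Y_def
      using scaleR_scaleC[of 0 x] by (intro sum.cong refl) (simp add: X_simps(3))
    then show ?thesis using Y_G[OF that, of "\<lambda>j. if j = i then 1 else 0"] by simp
  qed
  have sigma_G: "(sigma_op X ^^ k) P g \<in> G" for k g
  proof (induction k arbitrary: g)
    case 0 then show ?case by (simp add: W_G P_in_W)
  next
    case (Suc k)
    show ?case unfolding sigma_pow_Suc by (intro subspace_sum[OF sub] X_G Suc.IH)
  qed
  then have P0: "h \<bullet> (sigma_op X ^^ k) P g = 0" for k g
    unfolding G_def by (metis (mono_tags, lifting) funpow_0 mem_Collect_eq)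
  have "s * (h \<bullet> h) \<ge> 0" for s
  proof -
    have "(\<lambda>k. s * (h \<bullet> S k h)) \<longlonglongrightarrow> s * (h \<bullet> 0)"
      using pure by (intro tendsto_intros) (simp add: pure_tuple_def)
    then have "s * (h \<bullet> S 0 h) \<ge> 0"
      by (intro fdiff_funpow_nonneg[of m "\<lambda>k. s * (h \<bullet> S k h)"])
        (simp_all add: fdiff_inner_sigma P0)
    then show ?thesis by simp
  qed
  from this[of "-1"] have "h \<bullet> h \<le> 0" by simp
  then show ?thesis by (metis inner_gt_zero_iff not_le)
qed

end

section \<open>Contractions commuting with the tuple\<close>

locale delta_tuple_commutant = delta_tuple X m
  for X :: "'n::finite \<Rightarrow> 'a::complex_hilbert_space \<Rightarrow> 'a" and m +
  fixes T :: "'a \<Rightarrow> 'a"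
  assumes contraction: "contraction_on UNIV T" and T_X: "T (X i x) = X i (T x)"
begin

lemma norm_T: "norm (T x) \<le> norm x"
  and T_add: "T (x + y) = T x + T y" and T_scaleC: "T (c *\<^sub>C x) = c *\<^sub>C T x"
  using contraction by (simp_all add: contraction_on_def)

lemma bounded_clinear_T: "bounded_clinear T"
  unfolding bounded_clinear_def
  by (intro conjI bounded_linear_intro[where K=1]) (simp_all add: norm_T T_add T_scaleC scaleR_scaleC)

abbreviation R :: "'a \<Rightarrow> 'a" where "R \<equiv> cadjoint T"

lemmas bounded_clinear_R = bounded_clinear_cadjoint[OF bounded_clinear_T]
lemmas bounded_linear_R = bounded_clinearD(1)[OF bounded_clinear_R]
lemmas bounded_linear_R_pow = bounded_linear_funpow[OF bounded_linear_R]
lemmas R_pow_simps = linear_simps[OF bounded_linear_R_pow]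

lemma norm_R: "norm (R h) \<le> norm h"
proof -
  have "norm (R h) * norm (R h) = T (R h) \<bullet> h"
    unfolding inner_cadjoint[OF bounded_clinear_T] by (simp add: dot_square_norm power2_eq_square)
  also have "\<dots> \<le> norm (T (R h)) * norm h" by (rule norm_cauchy_schwarz)
  also have "\<dots> \<le> norm (R h) * norm h" using norm_T by (simp add: mult_right_mono)
  finally show ?thesis by (cases "R h = 0") auto
qed

lemma norm_R_pow: "norm ((R ^^ k) h) \<le> norm h"
  by (induction k) (auto intro: order_trans[OF norm_R])

lemma R_pow_scaleC: "(R ^^ k) (c *\<^sub>C h) = c *\<^sub>C (R ^^ k) h"
  by (induction k) (simp_all add: bounded_clinearD(2)[OF bounded_clinear_R])

lemma V_R: "V i (R h) = R (V i h)"
  by (rule inner_left_eqI) (simp flip: inner_X(1) inner_cadjoint(1)[OF bounded_clinear_T] add: T_X)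

lemma V_R_pow: "V i ((R ^^ k) h) = (R ^^ k) (V i h)"
  by (induction k) (simp_all add: V_R)

lemma R_W: "w \<in> W \<Longrightarrow> R w \<in> W"
  using linear_0[OF bounded_linear.linear[OF bounded_linear_R]] by (simp add: wandering_iff V_R)

section \<open>The subspace on which the powers of \<open>R\<close> tend to 0\<close>

definition N :: "'a set" where "N = {h. (\<lambda>k. (R ^^ k) h) \<longlonglongrightarrow> 0}"

text \<open>\<open>R\<close> is a contraction, so the norms along an orbit never increase and one
  small value suffices.\<close>

lemma N_iff: "h \<in> N \<longleftrightarrow> (\<forall>e>0. \<exists>k. norm ((R ^^ k) h) < e)"
proof
  assume "h \<in> N"
  then show "\<forall>e>0. \<exists>k. norm ((R ^^ k) h) < e"
    by (auto simp: N_def lim_sequentially)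
next
  assume small: "\<forall>e>0. \<exists>k. norm ((R ^^ k) h) < e"
  have "\<exists>k. \<forall>l\<ge>k. norm ((R ^^ l) h) < e" if "e > 0" for e
  proof -
    obtain k where k: "norm ((R ^^ k) h) < e" using small \<open>e > 0\<close> by blast
    have "norm ((R ^^ l) h) < e" if "l \<ge> k" for l
      using norm_R_pow[of "l - k" "(R ^^ k) h"] that k
      by (metis comp_apply funpow_add le_add_diff_inverse2 le_less_trans)
    then show ?thesis by blast
  qed
  then show "h \<in> N" by (simp add: N_def LIMSEQ_iff)
qed

lemma subspace_N: "subspace N"
proof -
  have "x + y \<in> N" if "x \<in> N" "y \<in> N" for x y
    using that tendsto_add[of "\<lambda>k. (R ^^ k) x" 0 sequentially "\<lambda>k. (R ^^ k) y" 0]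
    by (simp add: N_def R_pow_simps)
  moreover have "r *\<^sub>R x \<in> N" if "x \<in> N" for x r
    using that tendsto_scaleR[OF tendsto_const, of "\<lambda>k. (R ^^ k) x" 0 sequentially r]
    by (simp add: N_def R_pow_simps)
  ultimately show ?thesis by (simp add: subspace_def) (simp add: N_def R_pow_simps)
qed

lemma closed_N: "closed N"
proof -
  have "h \<in> N" if h: "h \<in> closure N" for h
    unfolding N_iff
  proof (intro allI impI)
    fix e :: real assume "e > 0"
    then obtain n where n: "n \<in> N" "dist n h < e / 2" using h by (metis closure_approachable half_gt_zero)
    obtain k where k: "norm ((R ^^ k) n) < e / 2" using n(1) \<open>e > 0\<close> unfolding N_iff by (metis half_gt_zero)
    have "(R ^^ k) h = (R ^^ k) n + (R ^^ k) (h - n)" by (simp flip: R_pow_simps)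
    then have "norm ((R ^^ k) h) \<le> norm ((R ^^ k) n) + norm ((R ^^ k) (h - n))"
      by (metis norm_triangle_ineq)
    also have "\<dots> < e"
      using norm_R_pow[of k "h - n"] n(2) k by (simp add: dist_norm norm_minus_commute)
    finally show "\<exists>k. norm ((R ^^ k) h) < e" by blast
  qed
  then show ?thesis using closure_subset_eq by blast
qed

lemma scaleC_N: "h \<in> N \<Longrightarrow> c *\<^sub>C h \<in> N"
  using bounded_linear.tendsto_zero[OF bounded_linear_scaleC[of c], of "\<lambda>k. (R ^^ k) h"]
  by (simp add: N_def R_pow_scaleC)

text \<open>\<open>(R ^^ k) h\<close> splits into its projection to \<open>W\<close> and a term
  depending linearly on the vectors \<open>(R ^^ k) (V i h)\<close>. A large k makes the second term
  small. The first lies in \<open>N\<close>, so l further steps make it small without enlarging the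
  second.\<close>

lemma N_step:
  assumes WN: "W \<subseteq> N" and h: "\<And>i. V i h \<in> N"
  shows "h \<in> N"
  unfolding N_iff
proof (intro allI impI)
  fix e :: real assume "e > 0"
  let ?r = "\<lambda>k. \<Sum>i\<in>UNIV. X i (Delta m X ((R ^^ k) (V i h)))"
  have "?r \<longlonglongrightarrow> 0"
    using h by (intro tendsto_null_sum bounded_linear.tendsto_zero[OF bounded_linear_X]
        bounded_linear.tendsto_zero[OF bounded_linear_Delta]) (simp add: N_def)
  then obtain k where k: "norm (?r k) < e / 2"
    using LIMSEQ_D[of ?r 0 "e / 2"] \<open>e > 0\<close> by auto
  have "P ((R ^^ k) h) \<in> N" using WN P_in_W by blast
  then obtain l where l: "norm ((R ^^ l) (P ((R ^^ k) h))) < e / 2"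
    using \<open>e > 0\<close> unfolding N_iff by (metis half_gt_zero)
  have "(R ^^ (l + k)) h = (R ^^ l) (P ((R ^^ k) h) + ?r k)"
    by (simp add: funpow_add P_def V_R_pow)
  also have "\<dots> = (R ^^ l) (P ((R ^^ k) h)) + (R ^^ l) (?r k)" by (simp only: R_pow_simps)
  finally have "norm ((R ^^ (l + k)) h) \<le> norm ((R ^^ l) (P ((R ^^ k) h))) + norm ((R ^^ l) (?r k))"
    by (simp only: norm_triangle_ineq)
  also have "\<dots> < e" using l k norm_R_pow[of l "?r k"] by linarith
  finally show "\<exists>k. norm ((R ^^ k) h) < e" by blast
qed

text \<open>By \<open>V_A_pow\<close> and \<open>N_step\<close>, induction on the exponent puts
  every Taylor coefficient into \<open>N\<close>; a vector orthogonal to the closed subspace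
  \<open>N\<close> is then 0 by density.\<close>

lemma N_UNIV:
  assumes WN: "W \<subseteq> N"
  shows "N = UNIV"
proof -
  have A_N: "(A c ^^ n) w \<in> N" if w: "w \<in> W" for c n w
  proof (induction n)
    case 0 then show ?case using w WN by auto
  next
    case (Suc n)
    show ?case by (rule N_step[OF WN]) (simp only: V_A_pow[OF w] scaleC_N Suc.IH)
  qed
  have "h \<in> N" for h
  proof -
    obtain p q where pq: "h = p + q" "p \<in> N" "\<And>s. s \<in> N \<Longrightarrow> q \<bullet> s = 0"
      using hilbert_projection[OF closed_N subspace_N] by metis
    then have "q = 0" by (intro orth_Taylor_imp_zero) (simp add: A_N)
    then show ?thesis using pq by simp
  qed
  then show ?thesis by blast
qed

text \<open>\<open>R\<close> leaves \<open>W\<close> invariant, so its restriction satisfies the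
  defining property of the adjoint on \<open>W\<close>. Any other choice agrees with it there, since
  their difference lies in \<open>W\<close> and can itself be used as test vector.\<close>

lemma adjoint_compression:
  assumes y: "y \<in> W"
  shows "adjoint_on W W (orth_proj W \<circ> T) y = R y"
proof -
  let ?B = "adjoint_on W W (orth_proj W \<circ> T)"
  let ?Q = "\<lambda>B. (\<forall>y\<in>W. B y \<in> W) \<and> (\<forall>x\<in>W. \<forall>y\<in>W. cinner ((orth_proj W \<circ> T) x) y = cinner x (B y))"
  have "cinner (P x) y = cinner x y" if "y \<in> W" for x y
    by (rule cinner_eqI) (use inner_P_W[OF that] in \<open>simp flip: P_simps\<close>)
  then have "?Q R"
    by (simp add: R_W orth_proj_W flip: cinner_cadjoint[OF bounded_clinear_T])
  then have "?Q ?B" unfolding adjoint_on_def[of W W] by (rule someI[of ?Q R])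
  then have B: "?B y \<in> W" "x \<in> W \<Longrightarrow> cinner x (?B y) = cinner x (R y)" for x
    using y \<open>?Q R\<close> by auto
  then have d: "?B y - R y \<in> W" using subspace_diff[OF subspace_W] R_W y by blast
  have "(?B y - R y) \<bullet> (?B y - R y) = 0"
    unfolding inner_diff_right by (simp only: inner_eq_Re_cinner B(2)[OF d] diff_self)
  then show ?thesis by simp
qed

lemma contraction_compression: "contraction_on W (orth_proj W \<circ> T)"
  using order_trans[OF norm_P_le norm_T]
  by (simp add: contraction_on_def orth_proj_W P_in_W T_add T_scaleC P_simps)

lemma pure_iff_W_N: "pure_contraction_on W (orth_proj W \<circ> T) \<longleftrightarrow> W \<subseteq> N"
proof -
  have "(B ^^ k) h = (R ^^ k) h \<and> (R ^^ k) h \<in> W"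
    if "\<And>y. y \<in> W \<Longrightarrow> B y = R y" "h \<in> W" for B h k
    by (induction k) (simp_all add: that R_W)
  from this[of "adjoint_on W W (orth_proj W \<circ> T)", OF adjoint_compression]
  have "(adjoint_on W W (orth_proj W \<circ> T) ^^ k) h = (R ^^ k) h" if "h \<in> W" for h k
    using that by blast
  then show ?thesis
    by (auto simp: pure_contraction_on_def contraction_compression N_def tendsto_norm_zero_iff)
qed

lemma pure_iff_N: "pure_contraction_on UNIV T \<longleftrightarrow> N = UNIV"
  by (auto simp: pure_contraction_on_def contraction N_def tendsto_norm_zero_iff)

end

theorem theorem4p9:
  fixes X :: "'n::finite \<Rightarrow> 'a::complex_hilbert_space \<Rightarrow> 'a"
    and T :: "'a \<Rightarrow> 'a"
    and m :: nat
  assumes "commuting_tuple X"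
    and "pure_tuple X"
    and "regular_at_0 X"
    and "m \<ge> 1"
    and "\<forall>u \<in> range (cadjoint (row_op X)). gram_inverse X u = ampliation (Delta m X) u"
    and "contraction_on UNIV T"
    and "\<forall>i. T \<circ> X i = X i \<circ> T"
  shows "pure_contraction_on UNIV T \<longleftrightarrow>
    pure_contraction_on (wandering X) (orth_proj (wandering X) \<circ> T)"
proof -
  interpret delta_tuple_commutant X m T
    using assms by unfold_locales (auto simp: fun_eq_iff)
  show ?thesis using N_UNIV by (auto simp: pure_iff_N pure_iff_W_N)
qed

end
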